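(* Let $X$ be a finite cell complex and let $n\ge2$. Let $\Delta_{n-1}$ be the $(n-1)$-simplex on vertex set $[n]$, and let $X\times\Delta_{n-1}$ be the product cell complex whose cells are the products $\alpha\times\beta$ of cells $\alpha$ of $X$ and simplices $\beta$ of $\Delta_{n-1}$. Then for all $k\ge0$, $$h^k(X\times\Delta_{n-1})\ \ge\ \min\Big\{h^k(X),\ \max\Big\{1,\frac{n}{k+2}\Big\}\Big\}.$$
   Context: Cochains have $\mathbb{Z}_2$ coefficients (non-reduced, $C^{-1}=0$); $\|\phi\|$ is the number of cells where $\phi$ is nonzero, $\|\phi\|_{csy}=\min_{\psi\in C^{k-1}}\|\phi+d_{k-1}\psi\|$, and $h^k(Z)=\min\{\|d_k\phi\|/\|\phi\|_{csy}:\phi\in C^k(Z)\setminus B^k(Z)\}$ with $B^k=d_{k-1}C^{k-1}$. *)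

theory Defs
  imports Complex_Main "HOL-Library.Z2" "HOL-Library.Extended_Real"
begin

text \<open>
  A finite cell complex is given by its cells, their dimensions and the mod 2 incidence
  numbers (\<open>incidence X \<tau> \<sigma>\<close> is the coefficient of the cell \<open>\<sigma>\<close> in the cellular boundary of the
  cell \<open>\<tau>\<close>; only pairs with \<open>cell_dim X \<tau> = cell_dim X \<sigma> + 1\<close> are ever used).
  For a finite CW complex \<open>incidence X \<tau> \<sigma>\<close> is the degree mod 2 of the attaching map of \<open>\<tau>\<close>
  over \<open>\<sigma>\<close>; for a regular (e.g. polyhedral or simplicial) one it is 1 iff \<open>\<sigma>\<close> is a facet
  of \<open>\<tau>\<close>.
\<close>

record 'a cell_complex =
  cells :: "'a set"
  cell_dim :: "'a \<Rightarrow> nat"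
  incidence :: "'a \<Rightarrow> 'a \<Rightarrow> bit"

text \<open>The index ranges over the integers, so that there are no cells of dimension -1.\<close>

definition cells_of_dim :: "('a, 'z) cell_complex_scheme \<Rightarrow> int \<Rightarrow> 'a set" where
  "cells_of_dim X k = {\<sigma> \<in> cells X. int (cell_dim X \<sigma>) = k}"

text \<open>
  The two conditions on incidences say that the boundary of a 1-cell is the mod 2 sum of its
  two end points (which is 0 if they coincide), and that the boundary of a boundary is 0.
\<close>

locale finite_cell_complex =
  fixes X :: "('a, 'z) cell_complex_scheme"
  assumes finite_cells: "finite (cells X)"
    and end_points: "\<tau> \<in> cells_of_dim X 1 \<Longrightarrow>
      card {\<sigma> \<in> cells_of_dim X 0. incidence X \<tau> \<sigma> \<noteq> 0} \<in> {0, 2}"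
    and boundary_boundary: "\<lbrakk>\<tau> \<in> cells_of_dim X (k + 1); \<sigma> \<in> cells_of_dim X (k - 1)\<rbrakk> \<Longrightarrow>
      (\<Sum>\<rho>\<in>cells_of_dim X k. incidence X \<tau> \<rho> * incidence X \<rho> \<sigma>) = 0"

definition cochains :: "('a, 'z) cell_complex_scheme \<Rightarrow> int \<Rightarrow> ('a \<Rightarrow> bit) set" where
  "cochains X k = {\<phi>. \<forall>\<sigma>. \<sigma> \<notin> cells_of_dim X k \<longrightarrow> \<phi> \<sigma> = 0}"

definition coboundary :: "('a, 'z) cell_complex_scheme \<Rightarrow> int \<Rightarrow> ('a \<Rightarrow> bit) \<Rightarrow> 'a \<Rightarrow> bit" where
  "coboundary X k \<phi> = (\<lambda>\<tau>. if \<tau> \<in> cells_of_dim X (k + 1)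
     then \<Sum>\<sigma>\<in>cells_of_dim X k. incidence X \<tau> \<sigma> * \<phi> \<sigma> else 0)"

definition coboundaries :: "('a, 'z) cell_complex_scheme \<Rightarrow> int \<Rightarrow> ('a \<Rightarrow> bit) set" where
  "coboundaries X k = coboundary X (k - 1) ` cochains X (k - 1)"

definition cochain_norm :: "('a, 'z) cell_complex_scheme \<Rightarrow> ('a \<Rightarrow> bit) \<Rightarrow> nat" where
  "cochain_norm X \<phi> = card {\<sigma> \<in> cells X. \<phi> \<sigma> \<noteq> 0}"

definition cosystolic_norm :: "('a, 'z) cell_complex_scheme \<Rightarrow> int \<Rightarrow> ('a \<Rightarrow> bit) \<Rightarrow> nat" where
  "cosystolic_norm X k \<phi> =
     Min ((\<lambda>\<psi>. cochain_norm X (\<lambda>\<sigma>. \<phi> \<sigma> + coboundary X (k - 1) \<psi> \<sigma>)) ` cochains X (k - 1))"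

text \<open>
  The minimum over the finite set \<open>cochains X k - coboundaries X k\<close> is an infimum in the
  extended reals, so that it is \<open>\<infinity>\<close> if every k-cochain is a coboundary.
\<close>

definition cheeger :: "int \<Rightarrow> ('a, 'z) cell_complex_scheme \<Rightarrow> ereal" where
  "cheeger k X = (INF \<phi>\<in>cochains X k - coboundaries X k.
     ereal (real (cochain_norm X (coboundary X k \<phi>)) / real (cosystolic_norm X k \<phi>)))"

text \<open>The simplex on the vertex set \<open>{1..n}\<close>, of dimension \<open>n - 1\<close>; the empty set is not a cell.\<close>

definition simplex :: "nat \<Rightarrow> nat set cell_complex" where
  "simplex n = \<lparr>cells = {\<beta>. \<beta> \<subseteq> {1..n} \<and> \<beta> \<noteq> {}},
     cell_dim = (\<lambda>\<beta>. card \<beta> - 1),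
     incidence = (\<lambda>\<beta>' \<beta>. of_bool (\<beta> \<subseteq> \<beta>'))\<rparr>"

text \<open>
  The pair of cells \<open>(\<alpha>, \<beta>)\<close> stands for the cell \<open>\<alpha> \<times> \<beta>\<close>; the incidence numbers are those of
  the Leibniz rule \<open>\<partial>(\<alpha> \<times> \<beta>) = \<partial>\<alpha> \<times> \<beta> + \<alpha> \<times> \<partial>\<beta>\<close>. At most one of the two summands
  below can be nonzero: the first one requires \<open>\<alpha> \<noteq> \<alpha>'\<close>, the second one \<open>\<alpha> = \<alpha>'\<close>.
\<close>

definition product_complex ::
  "('a, 'z) cell_complex_scheme \<Rightarrow> ('b, 'w) cell_complex_scheme \<Rightarrow> ('a \<times> 'b) cell_complex"
  (infixr "\<times>\<^sub>c" 80) where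
  "X \<times>\<^sub>c Y = \<lparr>cells = cells X \<times> cells Y,
     cell_dim = (\<lambda>(\<alpha>, \<beta>). cell_dim X \<alpha> + cell_dim Y \<beta>),
     incidence = (\<lambda>(\<alpha>', \<beta>') (\<alpha>, \<beta>).
       (if \<beta> = \<beta>' \<and> cell_dim X \<alpha>' = cell_dim X \<alpha> + 1 then incidence X \<alpha>' \<alpha> else 0) +
       (if \<alpha> = \<alpha>' \<and> cell_dim Y \<beta>' = cell_dim Y \<beta> + 1 then incidence Y \<beta>' \<beta> else 0))\<rparr>"


lemma bit_add_self: "(x::bit) + x = 0"
  by (cases x) auto

lemma finite_cell_complex_simplex: "finite_cell_complex (simplex n)"
proof
  show "finite (cells (simplex n))"
    by (rule finite_subset[of _ "Pow {1..n}"]) (auto simp: simplex_def)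
next
  fix \<tau> assume "\<tau> \<in> cells_of_dim (simplex n) 1"
  then have \<tau>: "\<tau> \<subseteq> {1..n}" "card \<tau> = 2"
    by (auto simp: cells_of_dim_def simplex_def)
  have "{\<sigma> \<in> cells_of_dim (simplex n) 0. incidence (simplex n) \<tau> \<sigma> \<noteq> 0} = (\<lambda>x. {x}) ` \<tau>"
  proof (intro equalityI subsetI)
    fix \<sigma> assume "\<sigma> \<in> {\<sigma> \<in> cells_of_dim (simplex n) 0. incidence (simplex n) \<tau> \<sigma> \<noteq> 0}"
    then have "\<sigma> \<subseteq> \<tau>" "\<sigma> \<noteq> {}" "card \<sigma> \<le> 1"
      by (auto simp: cells_of_dim_def simplex_def split: if_splits)
    moreover have "finite \<tau>" using \<tau> finite_subset by blast
    ultimately have "card \<sigma> = 1"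
      by (metis card_0_eq finite_subset less_one nat_less_le not_le)
    then show "\<sigma> \<in> (\<lambda>x. {x}) ` \<tau>"
      using \<open>\<sigma> \<subseteq> \<tau>\<close> by (auto simp: card_1_singleton_iff)
  qed (use \<tau> in \<open>auto simp: cells_of_dim_def simplex_def\<close>)
  moreover have "card ((\<lambda>x. {x}) ` \<tau>) = 2"
    using \<tau> by (simp add: card_image)
  ultimately show "card {\<sigma> \<in> cells_of_dim (simplex n) 0. incidence (simplex n) \<tau> \<sigma> \<noteq> 0} \<in> {0, 2}"
    by simp
next
  fix \<tau> k \<sigma>
  assume "\<tau> \<in> cells_of_dim (simplex n) (k + 1)" "\<sigma> \<in> cells_of_dim (simplex n) (k - 1)"
  then have sub: "\<tau> \<subseteq> {1..n}" "\<sigma> \<subseteq> {1..n}" "\<tau> \<noteq> {}" "\<sigma> \<noteq> {}"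
    and dims: "int (card \<tau> - 1) = k + 1" "int (card \<sigma> - 1) = k - 1"
    by (auto simp: cells_of_dim_def simplex_def)
  have fin: "finite \<tau>" "finite \<sigma>" using sub finite_subset by blast+
  then have pos: "card \<tau> > 0" "card \<sigma> > 0" using sub by auto
  let ?R = "{\<rho> \<in> cells_of_dim (simplex n) k. \<sigma> \<subseteq> \<rho> \<and> \<rho> \<subseteq> \<tau>}"
  have finR: "finite (cells_of_dim (simplex n) k)"
    by (rule finite_subset[of _ "Pow {1..n}"]) (auto simp: simplex_def cells_of_dim_def)
  have "(\<Sum>\<rho>\<in>cells_of_dim (simplex n) k.
      incidence (simplex n) \<tau> \<rho> * incidence (simplex n) \<rho> \<sigma>) = (\<Sum>\<rho>\<in>?R. 1)"
    by (rule sum.mono_neutral_cong_right) (use finR in \<open>auto simp: simplex_def\<close>)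
  also have "\<dots> = of_nat (card ?R)" by simp
  also have "\<dots> = 0"
  proof (cases "\<sigma> \<subseteq> \<tau>")
    case True
    have "?R = (\<lambda>x. insert x \<sigma>) ` (\<tau> - \<sigma>)"
    proof (intro equalityI subsetI)
      fix \<rho> assume \<rho>: "\<rho> \<in> ?R"
      then have "finite \<rho>" "\<rho> \<noteq> {}" "int (card \<rho> - 1) = k"
        using fin finite_subset by (auto simp: cells_of_dim_def simplex_def)
      moreover from this have "card \<rho> > 0" by auto
      ultimately have "card \<rho> = card \<sigma> + 1" using dims pos by linarith
      then have "card (\<rho> - \<sigma>) = 1"
        using \<rho> fin by (simp add: card_Diff_subset)
      then obtain x where "\<rho> - \<sigma> = {x}" by (auto simp: card_1_singleton_iff)
      then have "\<rho> = insert x \<sigma>" "x \<in> \<tau> - \<sigma>" using \<rho> by auto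
      then show "\<rho> \<in> (\<lambda>x. insert x \<sigma>) ` (\<tau> - \<sigma>)" by blast
    next
      fix \<rho> assume "\<rho> \<in> (\<lambda>x. insert x \<sigma>) ` (\<tau> - \<sigma>)"
      then show "\<rho> \<in> ?R"
        using True sub fin dims pos by (auto simp: cells_of_dim_def simplex_def)
    qed
    moreover have "inj_on (\<lambda>x. insert x \<sigma>) (\<tau> - \<sigma>)"
      by (auto simp: inj_on_def)
    ultimately have "card ?R = card (\<tau> - \<sigma>)" by (simp add: card_image)
    also have "\<dots> = 2"
      using True fin dims pos by (simp add: card_Diff_subset)
    finally show ?thesis by simp
  next
    case False
    then have "?R = {}" by blast
    then show ?thesis by (metis card.empty of_nat_0)
  qed
  finally show "(\<Sum>\<rho>\<in>cells_of_dim (simplex n) k.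
      incidence (simplex n) \<tau> \<rho> * incidence (simplex n) \<rho> \<sigma>) = 0" .
qed

lemma finite_cell_complex_product:
  assumes "finite_cell_complex X" "finite_cell_complex Y"
  shows "finite_cell_complex (X \<times>\<^sub>c Y)"
proof
  interpret X: finite_cell_complex X by fact
  interpret Y: finite_cell_complex Y by fact
  show "finite (cells (X \<times>\<^sub>c Y))"
    using X.finite_cells Y.finite_cells by (simp add: product_complex_def)
  show "card {\<sigma> \<in> cells_of_dim (X \<times>\<^sub>c Y) 0. incidence (X \<times>\<^sub>c Y) \<tau> \<sigma> \<noteq> 0} \<in> {0, 2}"
    if \<tau>: "\<tau> \<in> cells_of_dim (X \<times>\<^sub>c Y) 1" for \<tau>
  proof -
    obtain a b where ab: "\<tau> = (a, b)" by force
    let ?S = "{\<sigma> \<in> cells_of_dim (X \<times>\<^sub>c Y) 0. incidence (X \<times>\<^sub>c Y) \<tau> \<sigma> \<noteq> 0}"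
    consider "a \<in> cells_of_dim X 1" "b \<in> cells_of_dim Y 0"
      | "a \<in> cells_of_dim X 0" "b \<in> cells_of_dim Y 1"
      using \<tau> ab by (fastforce simp: cells_of_dim_def product_complex_def)
    then show ?thesis
    proof cases
      case 1
      then have "?S = {\<sigma> \<in> cells_of_dim X 0. incidence X a \<sigma> \<noteq> 0} \<times> {b}"
        by (auto simp: ab cells_of_dim_def product_complex_def split: if_splits)
      then show ?thesis using X.end_points[OF 1(1)] by (simp add: card_cartesian_product)
    next
      case 2
      then have "?S = {a} \<times> {\<sigma> \<in> cells_of_dim Y 0. incidence Y b \<sigma> \<noteq> 0}"
        by (auto simp: ab cells_of_dim_def product_complex_def split: if_splits)
      then show ?thesis using Y.end_points[OF 2(2)] by (simp add: card_cartesian_product)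
    qed
  qed
  show "(\<Sum>\<rho>\<in>cells_of_dim (X \<times>\<^sub>c Y) k. incidence (X \<times>\<^sub>c Y) \<tau> \<rho> * incidence (X \<times>\<^sub>c Y) \<rho> \<sigma>) = 0"
    if \<tau>: "\<tau> \<in> cells_of_dim (X \<times>\<^sub>c Y) (k + 1)" and \<sigma>: "\<sigma> \<in> cells_of_dim (X \<times>\<^sub>c Y) (k - 1)"
    for \<tau> \<sigma> k
  proof -
    obtain a b where ab: "\<tau> = (a, b)" by force
    obtain c d where cd: "\<sigma> = (c, d)" by force
    define F where "F = (\<lambda>x y. if cell_dim X x = cell_dim X y + 1 then incidence X x y else 0)"
    define G where "G = (\<lambda>x y. if cell_dim Y x = cell_dim Y y + 1 then incidence Y x y else 0)"
    define I where "I = incidence (X \<times>\<^sub>c Y)"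
    have I: "I (x, y) (x', y') =
        (if y' = y then F x x' else 0) + (if x' = x then G y y' else 0)" for x y x' y'
      by (auto simp: I_def product_complex_def F_def G_def)
    have cell: "a \<in> cells X" "b \<in> cells Y" "c \<in> cells X" "d \<in> cells Y"
      and dims: "int (cell_dim X a) + int (cell_dim Y b) = k + 1"
        "int (cell_dim X c) + int (cell_dim Y d) = k - 1"
      using \<tau> \<sigma> by (auto simp: ab cd cells_of_dim_def product_complex_def)
    have FF: "(\<Sum>x\<in>cells X. F a x * F x c) = 0" if "b = d"
    proof -
      have "(\<Sum>x\<in>cells X. F a x * F x c) =
          (\<Sum>x\<in>cells_of_dim X (int (cell_dim X a) - 1). incidence X a x * incidence X x c)"
        by (rule sum.mono_neutral_cong_right)
          (use X.finite_cells dims that in \<open>auto simp: F_def cells_of_dim_def split: if_splits\<close>)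
      also have "\<dots> = 0"
        by (rule X.boundary_boundary) (use cell dims that in \<open>auto simp: cells_of_dim_def\<close>)
      finally show ?thesis .
    qed
    have GG: "(\<Sum>y\<in>cells Y. G b y * G y d) = 0" if "a = c"
    proof -
      have "(\<Sum>y\<in>cells Y. G b y * G y d) =
          (\<Sum>y\<in>cells_of_dim Y (int (cell_dim Y b) - 1). incidence Y b y * incidence Y y d)"
        by (rule sum.mono_neutral_cong_right)
          (use Y.finite_cells dims that in \<open>auto simp: G_def cells_of_dim_def split: if_splits\<close>)
      also have "\<dots> = 0"
        by (rule Y.boundary_boundary) (use cell dims that in \<open>auto simp: cells_of_dim_def\<close>)
      finally show ?thesis .
    qed
    have "(\<Sum>\<rho>\<in>cells_of_dim (X \<times>\<^sub>c Y) k. I \<tau> \<rho> * I \<rho> \<sigma>) =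
        (\<Sum>\<rho>\<in>cells X \<times> cells Y. I \<tau> \<rho> * I \<rho> \<sigma>)"
    proof (rule sum.mono_neutral_left)
      show "finite (cells X \<times> cells Y)" using X.finite_cells Y.finite_cells by simp
      show "cells_of_dim (X \<times>\<^sub>c Y) k \<subseteq> cells X \<times> cells Y"
        by (auto simp: cells_of_dim_def product_complex_def)
      show "\<forall>\<rho>\<in>cells X \<times> cells Y - cells_of_dim (X \<times>\<^sub>c Y) k. I \<tau> \<rho> * I \<rho> \<sigma> = 0"
      proof
        fix \<rho> assume \<rho>: "\<rho> \<in> cells X \<times> cells Y - cells_of_dim (X \<times>\<^sub>c Y) k"
        obtain x y where xy: "\<rho> = (x, y)" by force
        have "int (cell_dim X x) + int (cell_dim Y y) \<noteq> k"
          using \<rho> by (auto simp: xy cells_of_dim_def product_complex_def)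
        then have "I \<tau> \<rho> = 0"
          using dims by (auto simp: I ab xy F_def G_def)
        then show "I \<tau> \<rho> * I \<rho> \<sigma> = 0" by simp
      qed
    qed
    also have "\<dots> = (\<Sum>x\<in>cells X. \<Sum>y\<in>cells Y. I \<tau> (x, y) * I (x, y) \<sigma>)"
      by (simp add: sum.cartesian_product)
    also have "\<dots> = (\<Sum>x\<in>cells X. \<Sum>y\<in>cells Y.
          (if y = b then if b = d then F a x * F x c else 0 else 0)
        + (if y = b then if x = c then F a c * G b d else 0 else 0)
        + (if y = d then if x = a then F a c * G b d else 0 else 0)
        + (if x = a then if a = c then G b y * G y d else 0 else 0))"
    proof (intro sum.cong refl)
      fix x y
      have expand: "(p + q) * (r + s) = p * r + p * s + q * r + q * s" for p q r s :: bit
        by (simp only: distrib_left distrib_right ac_simps)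
      have "I \<tau> (x, y) * I (x, y) \<sigma> =
          (if y = b then F a x else 0) * (if d = y then F x c else 0)
        + (if y = b then F a x else 0) * (if c = x then G y d else 0)
        + (if x = a then G b y else 0) * (if d = y then F x c else 0)
        + (if x = a then G b y else 0) * (if c = x then G y d else 0)"
        unfolding ab cd I expand ..
      also have "(if y = b then F a x else 0) * (if d = y then F x c else 0) =
          (if y = b then if b = d then F a x * F x c else 0 else 0)"
        by (cases "y = b"; cases "d = y") simp_all
      also have "(if y = b then F a x else 0) * (if c = x then G y d else 0) =
          (if y = b then if x = c then F a c * G b d else 0 else 0)"
        by (cases "y = b"; cases "c = x") simp_all
      also have "(if x = a then G b y else 0) * (if d = y then F x c else 0) =
          (if y = d then if x = a then F a c * G b d else 0 else 0)"
        by (cases "x = a"; cases "d = y") (simp_all add: mult.commute)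
      also have "(if x = a then G b y else 0) * (if c = x then G y d else 0) =
          (if x = a then if a = c then G b y * G y d else 0 else 0)"
        by (cases "x = a"; cases "c = x") simp_all
      finally show "I \<tau> (x, y) * I (x, y) \<sigma> =
          (if y = b then if b = d then F a x * F x c else 0 else 0)
        + (if y = b then if x = c then F a c * G b d else 0 else 0)
        + (if y = d then if x = a then F a c * G b d else 0 else 0)
        + (if x = a then if a = c then G b y * G y d else 0 else 0)" .
    qed
    also have "\<dots> = (\<Sum>x\<in>cells X. if b = d then F a x * F x c else 0)
        + (\<Sum>x\<in>cells X. if x = c then F a c * G b d else 0)
        + (\<Sum>x\<in>cells X. if x = a then F a c * G b d else 0)
        + (\<Sum>x\<in>cells X. if x = a then \<Sum>y\<in>cells Y. if a = c then G b y * G y d else 0 else 0)"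
    proof -
      have pull: "(\<Sum>y\<in>cells Y. if P then f y else 0) = (if P then sum f (cells Y) else 0)"
        for P and f :: "_ \<Rightarrow> bit" by simp
      show ?thesis
        unfolding sum.distrib sum.delta[OF Y.finite_cells] pull using cell by (simp only: if_True)
    qed
    also have "(\<Sum>x\<in>cells X. if b = d then F a x * F x c else 0) = 0"
      using FF by (cases "b = d") simp_all
    also have "(\<Sum>x\<in>cells X. if x = c then F a c * G b d else 0) = F a c * G b d"
      using cell by (simp only: sum.delta[OF X.finite_cells] if_True)
    also have "(\<Sum>x\<in>cells X. if x = a then F a c * G b d else 0) = F a c * G b d"
      using cell by (simp only: sum.delta[OF X.finite_cells] if_True)
    also have "(\<Sum>x\<in>cells X. if x = a then \<Sum>y\<in>cells Y. if a = c then G b y * G y d else 0 else 0)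
        = (\<Sum>y\<in>cells Y. if a = c then G b y * G y d else 0)"
      using cell by (simp only: sum.delta[OF X.finite_cells] if_True)
    also have "\<dots> = 0"
      using GG by (cases "a = c") simp_all
    also have "0 + F a c * G b d + F a c * G b d + 0 = 0"
      by (simp only: add_0_left add_0_right bit_add_self)
    finally show ?thesis by (simp add: I_def)
  qed
qed

end

theory Submission
  imports Defs
begin

text \<open>
  Coning with a vertex \<open>v\<close> is a cochain homotopy between the identity and the pullback along
  \<open>X \<times> \<Delta> \<rightarrow> X \<times> {v}\<close>. Hence \<open>\<phi>\<close> is cohomologous to the sum of the cone of \<open>d\<phi>\<close> and the pullback
  of \<open>\<phi>\<close> restricted to \<open>X \<times> {v}\<close>, and the latter may be changed by coboundaries of \<open>X\<close>. Its norm is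
  controlled by \<open>h\<^sup>k(X)\<close> and the cells of \<open>d\<phi>\<close> in \<open>X \<times> {v}\<close>. On averaging over \<open>v\<close>, a cell
  \<open>\<alpha> \<times> \<beta>\<close> of \<open>d\<phi>\<close> with \<open>dim \<beta> \<ge> 1\<close> contributes to the cones once for each of the at most
  \<open>min n (k + 2)\<close> vertices of \<open>\<beta>\<close>.
\<close>

section \<open>Cones and pullbacks of cochains on the product with a simplex\<close>

text \<open>Dual to joining a simplex with \<open>v\<close>; the join is degenerate, hence gives 0,
  if the simplex already contains \<open>v\<close>. Without the guard \<open>b \<noteq> {}\<close>
  the value at \<open>(a, {})\<close>, which is not a cell, could be nonzero.\<close>

definition cone :: "'b \<Rightarrow> ('a \<times> 'b set \<Rightarrow> bit) \<Rightarrow> 'a \<times> 'b set \<Rightarrow> bit" where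
  "cone v \<phi> = (\<lambda>(a, b). if v \<notin> b \<and> b \<noteq> {} then \<phi> (a, insert v b) else 0)"

text \<open>This is the pullback along the projection to \<open>X\<close>, which collapses every
  cell whose simplex factor has positive dimension; such cells get 0. Singletons outside
  \<open>{1..n}\<close> are not cells and get 0 too.\<close>

definition pullback :: "nat \<Rightarrow> ('a \<Rightarrow> bit) \<Rightarrow> 'a \<times> nat set \<Rightarrow> bit" where
  "pullback n f = (\<lambda>(a, b). if \<exists>w\<in>{1..n}. b = {w} then f a else 0)"

lemma cochains_zero: "\<phi> \<in> cochains X k \<Longrightarrow> \<sigma> \<notin> cells_of_dim X k \<Longrightarrow> \<phi> \<sigma> = 0"
  by (simp add: cochains_def)

lemma coboundary_in_cochains: "coboundary X k \<phi> \<in> cochains X (k + 1)"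
  by (simp add: cochains_def coboundary_def)

lemma coboundary_add:
  "coboundary X k (\<lambda>\<sigma>. \<phi> \<sigma> + \<psi> \<sigma>) = (\<lambda>\<tau>. coboundary X k \<phi> \<tau> + coboundary X k \<psi> \<tau>)"
  by (auto simp: coboundary_def distrib_left sum.distrib simp del: add_bit_eq_xor mult_bit_eq_and)

text \<open>Simplices are nonempty, so the truncated subtraction in \<open>card \<beta> - 1\<close>
  is exact and the degree condition becomes linear over the integers.\<close>

lemma cells_of_dim_product_simplex:
  "(a, b) \<in> cells_of_dim (X \<times>\<^sub>c simplex n) k \<longleftrightarrow>
    a \<in> cells X \<and> b \<subseteq> {1..n} \<and> b \<noteq> {} \<and> int (cell_dim X a) + int (card b) = k + 1"
proof -
  have "card b > 0" if "b \<subseteq> {1..n}" "b \<noteq> {}"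
    using that by (metis card_gt_0_iff finite_atLeastAtMost finite_subset)
  then show ?thesis
    by (fastforce simp: cells_of_dim_def product_complex_def simplex_def)
qed

lemma cells_of_dim_product_vertex:
  "(a, {v}) \<in> cells_of_dim (X \<times>\<^sub>c simplex n) k \<longleftrightarrow> a \<in> cells_of_dim X k \<and> v \<in> {1..n}"
  unfolding cells_of_dim_product_simplex by (auto simp: cells_of_dim_def)

lemma cone_in_cochains:
  assumes "\<phi> \<in> cochains (X \<times>\<^sub>c simplex n) (k + 1)"
  shows "cone v \<phi> \<in> cochains (X \<times>\<^sub>c simplex n) k"
  unfolding cochains_def
proof (intro CollectI allI impI)
  fix \<sigma> assume \<sigma>: "\<sigma> \<notin> cells_of_dim (X \<times>\<^sub>c simplex n) k"
  obtain a b where ab: "\<sigma> = (a, b)" by force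
  have "(a, insert v b) \<notin> cells_of_dim (X \<times>\<^sub>c simplex n) (k + 1)" if "v \<notin> b" "b \<noteq> {}"
  proof
    assume *: "(a, insert v b) \<in> cells_of_dim (X \<times>\<^sub>c simplex n) (k + 1)"
    then have "finite b" by (auto simp: cells_of_dim_product_simplex intro: finite_subset)
    with * \<sigma> that show False by (auto simp: ab cells_of_dim_product_simplex)
  qed
  then show "cone v \<phi> \<sigma> = 0"
    using cochains_zero[OF assms] by (auto simp: ab cone_def)
qed

lemma restrict_in_cochains:
  assumes "\<phi> \<in> cochains (X \<times>\<^sub>c simplex n) k"
  shows "(\<lambda>a. \<phi> (a, {v})) \<in> cochains X k"
proof -
  have "\<phi> (a, {v}) = 0" if "a \<notin> cells_of_dim X k" for a
    by (rule cochains_zero[OF assms])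
      (simp add: cells_of_dim_product_vertex that)
  then show ?thesis by (simp add: cochains_def)
qed

lemma pullback_in_cochains:
  assumes "f \<in> cochains X k"
  shows "pullback n f \<in> cochains (X \<times>\<^sub>c simplex n) k"
  using cochains_zero[OF assms]
  by (auto simp: cochains_def pullback_def cells_of_dim_product_vertex)

section \<open>The cosystolic norm and the Cheeger constant\<close>

context finite_cell_complex
begin

lemma finite_cells_of_dim: "finite (cells_of_dim X k)"
  using finite_cells by (simp add: cells_of_dim_def)

text \<open>Norms are bounded by the number of cells, so \<open>Min\<close> ranges over a finite
  set. The second claim takes from the assumption only that this set is nonempty; the zero cochain
  can serve there.\<close>

lemma cosystolic_norm_le:
  assumes "\<psi> \<in> cochains X (k - 1)"
  shows "cosystolic_norm X k \<phi> \<le> cochain_norm X (\<lambda>\<sigma>. \<phi> \<sigma> + coboundary X (k - 1) \<psi> \<sigma>)"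
    and cosystolic_norm_attained:
    "\<exists>\<psi>\<in>cochains X (k - 1).
      cosystolic_norm X k \<phi> = cochain_norm X (\<lambda>\<sigma>. \<phi> \<sigma> + coboundary X (k - 1) \<psi> \<sigma>)"
proof -
  let ?N = "(\<lambda>\<psi>. cochain_norm X (\<lambda>\<sigma>. \<phi> \<sigma> + coboundary X (k - 1) \<psi> \<sigma>)) ` cochains X (k - 1)"
  have "?N \<subseteq> {..card (cells X)}"
    using finite_cells by (auto simp: cochain_norm_def intro!: card_mono)
  then have fin: "finite ?N" using finite_subset by blast
  then show "cosystolic_norm X k \<phi> \<le> cochain_norm X (\<lambda>\<sigma>. \<phi> \<sigma> + coboundary X (k - 1) \<psi> \<sigma>)"
    unfolding cosystolic_norm_def by (intro Min_le imageI assms)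
  have "Min ?N \<in> ?N" using fin assms by (intro Min_in) auto
  then show "\<exists>\<psi>\<in>cochains X (k - 1).
      cosystolic_norm X k \<phi> = cochain_norm X (\<lambda>\<sigma>. \<phi> \<sigma> + coboundary X (k - 1) \<psi> \<sigma>)"
    unfolding cosystolic_norm_def by blast
qed

lemma zero_in_cochains: "(\<lambda>_. 0) \<in> cochains X k"
  by (simp add: cochains_def)

text \<open>Mod 2, a vanishing sum means that \<open>\<phi>\<close> agrees with a coboundary on the
  cells, and off the cells both are 0. Hence the cochains excluded in \<open>cheeger\<close> are
  exactly those with zero denominator.\<close>

lemma cosystolic_norm_eq_0_iff:
  assumes "\<phi> \<in> cochains X k"
  shows "cosystolic_norm X k \<phi> = 0 \<longleftrightarrow> \<phi> \<in> coboundaries X k"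
proof -
  have norm0: "cochain_norm X \<chi> = 0 \<longleftrightarrow> (\<forall>\<sigma>\<in>cells X. \<chi> \<sigma> = 0)" for \<chi>
    using finite_cells by (auto simp: cochain_norm_def)
  have eq0: "\<phi> \<sigma> + \<chi> \<sigma> = 0 \<longleftrightarrow> \<phi> \<sigma> = \<chi> \<sigma>" for \<chi> :: "'a \<Rightarrow> bit" and \<sigma>
    by (cases "\<phi> \<sigma>"; cases "\<chi> \<sigma>") auto
  have off: "\<phi> \<sigma> = coboundary X (k - 1) \<psi> \<sigma>" if "\<sigma> \<notin> cells X" for \<psi> \<sigma>
    using that assms coboundary_in_cochains[of X "k - 1" \<psi>]
    by (auto simp: cochains_def cells_of_dim_def)
  have *: "cochain_norm X (\<lambda>\<sigma>. \<phi> \<sigma> + coboundary X (k - 1) \<psi> \<sigma>) = 0 \<longleftrightarrow>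
      \<phi> = coboundary X (k - 1) \<psi>" for \<psi>
    unfolding norm0 eq0 using off by blast
  show ?thesis
  proof
    assume "cosystolic_norm X k \<phi> = 0"
    then obtain \<psi> where "\<psi> \<in> cochains X (k - 1)"
        "cochain_norm X (\<lambda>\<sigma>. \<phi> \<sigma> + coboundary X (k - 1) \<psi> \<sigma>) = 0"
      using cosystolic_norm_attained[OF zero_in_cochains, of k \<phi>] by metis
    then show "\<phi> \<in> coboundaries X k"
      unfolding * coboundaries_def by blast
  next
    assume "\<phi> \<in> coboundaries X k"
    then obtain \<psi> where "\<psi> \<in> cochains X (k - 1)" "\<phi> = coboundary X (k - 1) \<psi>"
      by (auto simp: coboundaries_def)
    then show "cosystolic_norm X k \<phi> = 0"
      using cosystolic_norm_le[of \<psi> k \<phi>] *[of \<psi>] by simp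
  qed
qed

text \<open>On coboundaries the cosystolic norm is 0 and the inequality is trivial, so it may range
  over all cochains. This removes the division and the separate case of an infinite Cheeger
  constant.\<close>

lemma le_cheeger_iff:
  "ereal c \<le> cheeger k X \<longleftrightarrow>
    (\<forall>\<phi>\<in>cochains X k. c * cosystolic_norm X k \<phi> \<le> cochain_norm X (coboundary X k \<phi>))"
proof -
  have pos: "cosystolic_norm X k \<phi> > 0" if "\<phi> \<in> cochains X k - coboundaries X k" for \<phi>
    using that cosystolic_norm_eq_0_iff by auto
  have "ereal c \<le> cheeger k X \<longleftrightarrow> (\<forall>\<phi>\<in>cochains X k - coboundaries X k.
      c \<le> cochain_norm X (coboundary X k \<phi>) / cosystolic_norm X k \<phi>)"
    by (simp add: cheeger_def le_INF_iff)
  also have "\<dots> \<longleftrightarrow> (\<forall>\<phi>\<in>cochains X k - coboundaries X k.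
      c * cosystolic_norm X k \<phi> \<le> cochain_norm X (coboundary X k \<phi>))"
    using pos by (intro ball_cong refl) (simp add: pos_le_divide_eq)
  also have "\<dots> \<longleftrightarrow> (\<forall>\<phi>\<in>cochains X k.
      c * cosystolic_norm X k \<phi> \<le> cochain_norm X (coboundary X k \<phi>))"
    using cosystolic_norm_eq_0_iff by (metis Diff_iff mult_zero_right of_nat_0 of_nat_0_le_iff)
  finally show ?thesis .
qed

section \<open>Coboundaries in the product with a simplex\<close>

text \<open>
  The faces \<open>b - {y}\<close> include the empty set if \<open>b\<close> is a vertex; it does not contribute, because
  it is not a cell.
\<close>

lemma coboundary_product_simplex:
  assumes \<phi>: "\<phi> \<in> cochains (X \<times>\<^sub>c simplex n) k"
    and ab: "(a, b) \<in> cells_of_dim (X \<times>\<^sub>c simplex n) (k + 1)"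
  shows "coboundary (X \<times>\<^sub>c simplex n) k \<phi> (a, b) =
    (\<Sum>x\<in>cells_of_dim X (int (cell_dim X a) - 1). incidence X a x * \<phi> (x, b)) +
    (\<Sum>y\<in>b. \<phi> (a, b - {y}))"
proof -
  let ?Z = "X \<times>\<^sub>c simplex n"
  let ?C = "cells_of_dim X (int (cell_dim X a) - 1)"
  have a: "a \<in> cells X" and b: "b \<subseteq> {1..n}" "b \<noteq> {}"
    and dim: "int (cell_dim X a) + int (card b) = k + 2"
    using ab by (auto simp: cells_of_dim_product_simplex)
  have finb: "finite b" using b finite_subset by blast
  have finZ: "finite (cells_of_dim ?Z k)"
    using finite_cell_complex.finite_cells_of_dim finite_cell_complex_product
      finite_cell_complex_simplex finite_cell_complex_axioms by blast
  \<comment> \<open>\<open>g\<close> and \<open>h\<close> are the two Leibniz summands, stripped of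
    the dimension conditions in \<open>incidence\<close>: on \<open>k\<close>-cells,
    \<open>y = b\<close> forces \<open>x\<close> to have dimension one less than \<open>a\<close>,
    and \<open>x = a\<close> forces \<open>y\<close> to have one vertex less than
    \<open>b\<close>.\<close>
  define g where "g = (\<lambda>(x, y). if y = b then incidence X a x * \<phi> (x, y) else 0)"
  define h where "h = (\<lambda>(x, y). if x = a \<and> y \<subseteq> b then \<phi> (x, y) else 0)"
  have gh: "incidence ?Z (a, b) \<rho> * \<phi> \<rho> = g \<rho> + h \<rho>" if "\<rho> \<in> cells_of_dim ?Z k" for \<rho>
  proof -
    obtain x y where xy: "\<rho> = (x, y)" by force
    have y: "y \<subseteq> {1..n}" "y \<noteq> {}" "int (cell_dim X x) + int (card y) = k + 1"
      using that by (auto simp: xy cells_of_dim_product_simplex)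
    then have "card y > 0" by (metis card_gt_0_iff finite_atLeastAtMost finite_subset)
    with y dim show ?thesis
      by (auto simp: xy g_def h_def product_complex_def simplex_def)
  qed
  have "coboundary ?Z k \<phi> (a, b) = (\<Sum>\<rho>\<in>cells_of_dim ?Z k. g \<rho>) + (\<Sum>\<rho>\<in>cells_of_dim ?Z k. h \<rho>)"
    using ab gh by (simp add: coboundary_def sum.distrib del: add_bit_eq_xor mult_bit_eq_and)
  also have "(\<Sum>\<rho>\<in>cells_of_dim ?Z k. g \<rho>) = (\<Sum>\<rho>\<in>(\<lambda>x. (x, b)) ` ?C. g \<rho>)"
  proof (rule sum.mono_neutral_right[OF finZ])
    show "(\<lambda>x. (x, b)) ` ?C \<subseteq> cells_of_dim ?Z k"
      using b dim by (auto simp: cells_of_dim_product_simplex) (auto simp: cells_of_dim_def)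
    show "\<forall>\<rho>\<in>cells_of_dim ?Z k - (\<lambda>x. (x, b)) ` ?C. g \<rho> = 0"
    proof
      fix \<rho> assume \<rho>: "\<rho> \<in> cells_of_dim ?Z k - (\<lambda>x. (x, b)) ` ?C"
      obtain x y where xy: "\<rho> = (x, y)" by force
      have "y \<noteq> b"
      proof
        assume "y = b"
        then have "(x, b) \<in> cells_of_dim ?Z k" using \<rho> by (simp add: xy)
        then have "x \<in> ?C" using dim
          unfolding cells_of_dim_product_simplex by (simp add: cells_of_dim_def)
        with \<rho> \<open>y = b\<close> show False by (auto simp: xy)
      qed
      then show "g \<rho> = 0" by (simp add: g_def xy)
    qed
  qed
  also have "\<dots> = (\<Sum>x\<in>?C. incidence X a x * \<phi> (x, b))"
    by (subst sum.reindex) (auto simp: inj_on_def g_def)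
  also have "(\<Sum>\<rho>\<in>cells_of_dim ?Z k. h \<rho>) = (\<Sum>\<rho>\<in>(\<lambda>y. (a, b - {y})) ` b. h \<rho>)"
  proof (rule sum.mono_neutral_cong)
    show "finite (cells_of_dim ?Z k)" by (rule finZ)
    show "finite ((\<lambda>y. (a, b - {y})) ` b)" using finb by simp
    show "h \<rho> = 0" if "\<rho> \<in> (\<lambda>y. (a, b - {y})) ` b - cells_of_dim ?Z k" for \<rho>
      using that cochains_zero[OF \<phi>, of \<rho>] by (auto simp: h_def)
    show "h \<rho> = 0" if \<rho>: "\<rho> \<in> cells_of_dim ?Z k - (\<lambda>y. (a, b - {y})) ` b" for \<rho>
    proof -
      obtain x y where xy: "\<rho> = (x, y)" by force
      have False if "x = a" "y \<subseteq> b"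
      proof -
        have "card b = card y + 1"
          using \<rho> dim that by (auto simp: xy cells_of_dim_product_simplex)
        then have "card (b - y) = 1"
          using that finb by (simp add: card_Diff_subset finite_subset)
        then obtain z where z: "b - y = {z}" by (auto simp: card_1_singleton_iff)
        then have "y = b - {z}" "z \<in> b" using that by auto
        with \<rho> that show False by (auto simp: xy)
      qed
      then show ?thesis by (auto simp: h_def xy)
    qed
  qed simp
  also have "\<dots> = (\<Sum>y\<in>b. \<phi> (a, b - {y}))"
    by (subst sum.reindex) (auto simp: inj_on_def h_def)
  finally show ?thesis .
qed

text \<open>A vertex has no proper face that is a cell, so only the faces in the \<open>X\<close>
  factor remain. This makes the Cheeger constant of \<open>X\<close> applicable on each copy of
  \<open>X\<close> over a vertex.\<close>

lemma coboundary_restrict: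
  assumes \<phi>: "\<phi> \<in> cochains (X \<times>\<^sub>c simplex n) k" and v: "v \<in> {1..n}"
  shows "coboundary X k (\<lambda>a. \<phi> (a, {v})) = (\<lambda>a. coboundary (X \<times>\<^sub>c simplex n) k \<phi> (a, {v}))"
proof
  fix a
  let ?Z = "X \<times>\<^sub>c simplex n"
  have iff: "(a, {v}) \<in> cells_of_dim ?Z (k + 1) \<longleftrightarrow> a \<in> cells_of_dim X (k + 1)"
    using v by (simp add: cells_of_dim_product_vertex)
  show "coboundary X k (\<lambda>a. \<phi> (a, {v})) a = coboundary ?Z k \<phi> (a, {v})"
  proof (cases "a \<in> cells_of_dim X (k + 1)")
    case True
    have "\<phi> (a, {}) = 0"
      by (rule cochains_zero[OF \<phi>]) (simp add: cells_of_dim_product_simplex)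
    moreover have "int (cell_dim X a) - 1 = k" using True by (simp add: cells_of_dim_def)
    ultimately show ?thesis
      using True iff coboundary_product_simplex[OF \<phi>, of a "{v}"] by (simp add: coboundary_def)
  next
    case False
    then show ?thesis using iff by (simp add: coboundary_def)
  qed
qed

text \<open>Over a vertex this is \<open>coboundary_restrict\<close>. Over an edge the two end
  points contribute \<open>f a\<close> twice, which cancels mod 2; over a larger simplex no facet is
  a vertex.\<close>

lemma coboundary_pullback:
  assumes f: "f \<in> cochains X k"
  shows "coboundary (X \<times>\<^sub>c simplex n) k (pullback n f) = pullback n (coboundary X k f)"
proof
  fix \<tau> :: "'a \<times> nat set"
  let ?Z = "X \<times>\<^sub>c simplex n"
  note p = pullback_in_cochains[OF f, of n]
  obtain a b where ab: "\<tau> = (a, b)" by force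
  show "coboundary (X \<times>\<^sub>c simplex n) k (pullback n f) \<tau> = pullback n (coboundary X k f) \<tau>"
  proof (cases "\<exists>w\<in>{1..n}. b = {w}")
    case True
    then obtain w where w: "w \<in> {1..n}" "b = {w}" by blast
    then have "(\<lambda>a. pullback n f (a, {w})) = f" by (auto simp: pullback_def)
    then have "coboundary ?Z k (pullback n f) (a, b) = coboundary X k f a"
      using fun_cong[OF coboundary_restrict[OF p w(1)], of a] w(2) by simp
    then show ?thesis using True by (simp add: ab pullback_def)
  next
    case False
    have "coboundary ?Z k (pullback n f) (a, b) = 0"
    proof (cases "(a, b) \<in> cells_of_dim ?Z (k + 1)")
      case True
      have finb: "finite b" and sub: "b \<subseteq> {1..n}" and ne: "b \<noteq> {}"
        using True by (auto simp: cells_of_dim_product_simplex intro: finite_subset)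
      have "(\<Sum>y\<in>b. pullback n f (a, b - {y})) = (\<Sum>y\<in>b. if card b = 2 then f a else 0)"
      proof (intro sum.cong refl)
        fix y assume y: "y \<in> b"
        have "(\<exists>w\<in>{1..n}. b - {y} = {w}) \<longleftrightarrow> card (b - {y}) = 1"
          using sub by (auto simp: card_1_singleton_iff)
        also have "\<dots> \<longleftrightarrow> card b = 2" using y finb by (auto simp: card_Diff_singleton)
        finally show "pullback n f (a, b - {y}) = (if card b = 2 then f a else 0)"
          by (simp add: pullback_def)
      qed
      also have "\<dots> = 0" by (cases "card b = 2") simp_all
      finally show ?thesis
        using coboundary_product_simplex[OF p True] False by (simp add: pullback_def)
    qed (simp add: coboundary_def)
    with False show ?thesis by (auto simp: ab pullback_def)
  qed
qed

section \<open>The cone homotopy\<close>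

text \<open>If \<open>v\<close> is not in \<open>b\<close>, the facets of the join of
  \<open>v\<close> and \<open>b\<close> are \<open>b\<close> itself and the joins of
  \<open>v\<close> with the facets of \<open>b\<close>; these give \<open>\<phi>\<close> and the
  coboundary of its cone. The pullback accounts for the join of \<open>v\<close> with the empty
  simplex, which \<open>cone\<close> omits.\<close>

lemma cone_homotopy:
  assumes \<phi>: "\<phi> \<in> cochains (X \<times>\<^sub>c simplex n) k" and v: "v \<in> {1..n}"
  shows "\<phi> \<sigma> + coboundary (X \<times>\<^sub>c simplex n) (k - 1) (cone v \<phi>) \<sigma> =
    cone v (coboundary (X \<times>\<^sub>c simplex n) k \<phi>) \<sigma> + pullback n (\<lambda>a. \<phi> (a, {v})) \<sigma>"
proof -
  let ?Z = "X \<times>\<^sub>c simplex n"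
  let ?p = "pullback n (\<lambda>a. \<phi> (a, {v}))"
  obtain a b where ab: "\<sigma> = (a, b)" by force
  have cone: "cone v \<phi> \<in> cochains ?Z (k - 1)"
    by (rule cone_in_cochains) (simp add: \<phi>)
  show ?thesis
  proof (cases "\<sigma> \<in> cells_of_dim ?Z k")
    case False
    then show ?thesis
      using cochains_zero[OF \<phi> False] cochains_zero[OF cone_in_cochains[OF coboundary_in_cochains] False]
        cochains_zero[OF pullback_in_cochains[OF restrict_in_cochains[OF \<phi>]] False]
      by (simp add: coboundary_def)
  next
    case True
    have finb: "finite b" and sub: "b \<subseteq> {1..n}" and ne: "b \<noteq> {}"
      and dim: "int (cell_dim X a) + int (card b) = k + 1" and a: "a \<in> cells X"
      using True by (auto simp: ab cells_of_dim_product_simplex intro: finite_subset)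
    let ?C = "cells_of_dim X (int (cell_dim X a) - 1)"
    have dcone: "coboundary ?Z (k - 1) (cone v \<phi>) (a, b) =
        (\<Sum>x\<in>?C. incidence X a x * cone v \<phi> (x, b)) + (\<Sum>y\<in>b. cone v \<phi> (a, b - {y}))"
      using coboundary_product_simplex[OF cone, of a b] True by (simp add: ab)
    show ?thesis
    proof (cases "v \<in> b")
      case v_in: True
      \<comment> \<open>Only the facet \<open>b - {v}\<close> avoids \<open>v\<close>, and its join
        with \<open>v\<close> is \<open>b\<close> again. For \<open>b = {v}\<close> this facet is
        empty, and the pullback supplies the term instead.\<close>
      have "(\<Sum>y\<in>b. cone v \<phi> (a, b - {y})) = (\<Sum>y\<in>b. if y = v then cone v \<phi> (a, b - {v}) else 0)"
        using v_in by (intro sum.cong refl) (auto simp: cone_def)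
      also have "\<dots> = cone v \<phi> (a, b - {v})" using finb v_in by simp
      also have "\<dots> = (if b = {v} then 0 else \<phi> (a, b))"
        using v_in by (auto simp: cone_def insert_absorb)
      finally have faces: "(\<Sum>y\<in>b. cone v \<phi> (a, b - {y})) = (if b = {v} then 0 else \<phi> (a, b))" .
      have "(\<Sum>x\<in>?C. incidence X a x * cone v \<phi> (x, b)) = 0"
        using v_in by (simp add: cone_def)
      then have "coboundary ?Z (k - 1) (cone v \<phi>) (a, b) = (if b = {v} then 0 else \<phi> (a, b))"
        unfolding dcone faces by simp
      moreover have "?p (a, b) = (if b = {v} then \<phi> (a, b) else 0)"
        using v v_in by (auto simp: pullback_def)
      moreover have "cone v (coboundary ?Z k \<phi>) (a, b) = 0" using v_in by (simp add: cone_def)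
      ultimately show ?thesis by (auto simp: ab)
    next
      case False
      have "(a, insert v b) \<in> cells_of_dim ?Z (k + 1)"
        using False finb sub dim a v by (simp add: cells_of_dim_product_simplex)
      then have "cone v (coboundary ?Z k \<phi>) (a, b) =
          (\<Sum>x\<in>?C. incidence X a x * \<phi> (x, insert v b)) +
          (\<Sum>y\<in>insert v b. \<phi> (a, insert v b - {y}))"
        using False ne coboundary_product_simplex[OF \<phi>] by (simp add: cone_def)
      also have "(\<Sum>x\<in>?C. incidence X a x * \<phi> (x, insert v b)) =
          (\<Sum>x\<in>?C. incidence X a x * cone v \<phi> (x, b))"
        using False ne by (simp add: cone_def)
      also have "(\<Sum>y\<in>insert v b. \<phi> (a, insert v b - {y})) =
          \<phi> (a, b) + (\<Sum>y\<in>b. \<phi> (a, insert v b - {y}))"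
        using False finb by (subst sum.insert) auto
      \<comment> \<open>For \<open>b = {y}\<close> the facet is \<open>{v}\<close>, where the cone
        contributes 0; the extra term restores it.\<close>
      also have "(\<Sum>y\<in>b. \<phi> (a, insert v b - {y})) =
          (\<Sum>y\<in>b. cone v \<phi> (a, b - {y}) + (if b = {y} then \<phi> (a, {v}) else 0))"
      proof (intro sum.cong refl)
        fix y assume "y \<in> b"
        then have "insert v b - {y} = insert v (b - {y})" "b - {y} = {} \<longleftrightarrow> b = {y}"
          using False by auto
        then show "\<phi> (a, insert v b - {y}) =
            cone v \<phi> (a, b - {y}) + (if b = {y} then \<phi> (a, {v}) else 0)"
          using False by (auto simp: cone_def)
      qed
      also have "\<dots> = (\<Sum>y\<in>b. cone v \<phi> (a, b - {y})) + (\<Sum>y\<in>b. if b = {y} then \<phi> (a, {v}) else 0)"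
        by (rule sum.distrib)
      also have "(\<Sum>y\<in>b. if b = {y} then \<phi> (a, {v}) else 0) = ?p (a, b)"
      proof (cases "\<exists>w. b = {w}")
        case True
        then show ?thesis using sub by (auto simp: pullback_def)
      qed (auto simp: pullback_def)
      finally have "cone v (coboundary ?Z k \<phi>) (a, b) =
          \<phi> (a, b) + coboundary ?Z (k - 1) (cone v \<phi>) (a, b) + ?p (a, b)"
        unfolding dcone by (simp only: ac_simps)
      \<comment> \<open>Adding the pullback to both sides produces it twice on the right, and it
        cancels mod 2.\<close>
      then show ?thesis
        unfolding ab by (simp only: add.assoc bit_add_self add_0_right)
    qed
  qed
qed

section \<open>Norm estimates for a fixed vertex and their sums over all vertices\<close>

text \<open>The test cochain is the cone of \<open>\<phi>\<close> plus the pullback of a minimizer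
  \<open>\<psi>\<close> for the restriction: the cone leaves a pulled back restriction, and
  \<open>\<psi>\<close> then shrinks it to its cosystolic norm.\<close>

lemma cosystolic_norm_product_simplex_le:
  assumes \<phi>: "\<phi> \<in> cochains (X \<times>\<^sub>c simplex n) k" and v: "v \<in> {1..n}"
  shows "cosystolic_norm (X \<times>\<^sub>c simplex n) k \<phi> \<le>
    cochain_norm (X \<times>\<^sub>c simplex n) (cone v (coboundary (X \<times>\<^sub>c simplex n) k \<phi>)) +
    n * cosystolic_norm X k (\<lambda>a. \<phi> (a, {v}))"
proof -
  let ?Z = "X \<times>\<^sub>c simplex n"
  interpret Z: finite_cell_complex ?Z
    by (intro finite_cell_complex_product finite_cell_complex_simplex finite_cell_complex_axioms)
  obtain \<psi> where \<psi>: "\<psi> \<in> cochains X (k - 1)"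
    and min: "cosystolic_norm X k (\<lambda>a. \<phi> (a, {v})) =
      cochain_norm X (\<lambda>a. \<phi> (a, {v}) + coboundary X (k - 1) \<psi> a)"
    using cosystolic_norm_attained[OF zero_in_cochains] by blast
  let ?f = "\<lambda>a. \<phi> (a, {v}) + coboundary X (k - 1) \<psi> a"
  let ?c = "cone v (coboundary ?Z k \<phi>)"
  let ?\<psi> = "\<lambda>\<sigma>. cone v \<phi> \<sigma> + pullback n \<psi> \<sigma>"
  have cone: "cone v \<phi> \<in> cochains ?Z (k - 1)"
    by (rule cone_in_cochains) (simp add: \<phi>)
  have "?\<psi> \<in> cochains ?Z (k - 1)"
    using cone pullback_in_cochains[OF \<psi>, of n] by (simp add: cochains_def)
  then have "cosystolic_norm ?Z k \<phi> \<le>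
      cochain_norm ?Z (\<lambda>\<sigma>. \<phi> \<sigma> + coboundary ?Z (k - 1) ?\<psi> \<sigma>)"
    by (rule Z.cosystolic_norm_le)
  also have "(\<lambda>\<sigma>. \<phi> \<sigma> + coboundary ?Z (k - 1) ?\<psi> \<sigma>) = (\<lambda>\<sigma>. ?c \<sigma> + pullback n ?f \<sigma>)"
  proof
    fix \<sigma>
    have "\<phi> \<sigma> + coboundary ?Z (k - 1) ?\<psi> \<sigma> =
        (\<phi> \<sigma> + coboundary ?Z (k - 1) (cone v \<phi>) \<sigma>) + pullback n (coboundary X (k - 1) \<psi>) \<sigma>"
      unfolding coboundary_add coboundary_pullback[OF \<psi>] by (simp only: add.assoc)
    also have "\<dots> = ?c \<sigma> + (pullback n (\<lambda>a. \<phi> (a, {v})) \<sigma> +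
        pullback n (coboundary X (k - 1) \<psi>) \<sigma>)"
      unfolding cone_homotopy[OF \<phi> v] by (simp only: add.assoc)
    also have "pullback n (\<lambda>a. \<phi> (a, {v})) \<sigma> + pullback n (coboundary X (k - 1) \<psi>) \<sigma> =
        pullback n ?f \<sigma>"
      by (cases \<sigma>) (simp add: pullback_def)
    finally show "\<phi> \<sigma> + coboundary ?Z (k - 1) ?\<psi> \<sigma> = ?c \<sigma> + pullback n ?f \<sigma>" .
  qed
  also have "cochain_norm ?Z (\<lambda>\<sigma>. ?c \<sigma> + pullback n ?f \<sigma>) \<le>
      card ({\<sigma> \<in> cells ?Z. ?c \<sigma> \<noteq> 0} \<union> {\<sigma> \<in> cells ?Z. pullback n ?f \<sigma> \<noteq> 0})"
    unfolding cochain_norm_def using Z.finite_cells by (intro card_mono) auto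
  also have "\<dots> \<le> cochain_norm ?Z ?c + card {\<sigma> \<in> cells ?Z. pullback n ?f \<sigma> \<noteq> 0}"
    unfolding cochain_norm_def by (rule card_Un_le)
  \<comment> \<open>Each cell in the support of \<open>?f\<close> occurs once over each of the
    \<open>n\<close> vertices.\<close>
  also have "card {\<sigma> \<in> cells ?Z. pullback n ?f \<sigma> \<noteq> 0} \<le>
      card ({a \<in> cells X. ?f a \<noteq> 0} \<times> (\<lambda>w. {w}) ` {1..n})"
    using finite_cells
    by (intro card_mono) (auto simp: pullback_def product_complex_def split: if_splits)
  also have "\<dots> = n * cochain_norm X ?f"
    by (simp add: cochain_norm_def card_cartesian_product card_image)
  finally show ?thesis unfolding min by simp
qed

text \<open>Inserting \<open>v\<close> embeds the support of the cone into the cells of the support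
  of \<open>\<phi>\<close> whose simplex contains \<open>v\<close>, so summing over \<open>v\<close>
  counts a cell at most once per vertex. The simplices reached have at least two vertices, hence the
  condition \<open>card b \<noteq> 1\<close>.\<close>

lemma sum_cochain_norm_cone_le:
  assumes \<phi>: "\<phi> \<in> cochains (X \<times>\<^sub>c simplex n) k"
  shows "(\<Sum>v\<in>{1..n}. cochain_norm (X \<times>\<^sub>c simplex n) (cone v \<phi>)) \<le>
    min n (nat (k + 1)) * card {(a, b) \<in> cells (X \<times>\<^sub>c simplex n). \<phi> (a, b) \<noteq> 0 \<and> card b \<noteq> 1}"
proof -
  let ?Z = "X \<times>\<^sub>c simplex n"
  interpret Z: finite_cell_complex ?Z
    by (intro finite_cell_complex_product finite_cell_complex_simplex finite_cell_complex_axioms)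
  let ?S = "{(a, b) \<in> cells ?Z. \<phi> (a, b) \<noteq> 0 \<and> card b \<noteq> 1}"
  have finS: "finite ?S" by (rule finite_subset[OF _ Z.finite_cells]) auto
  have inS: "a \<in> cells X \<and> b \<subseteq> {1..n} \<and> int (cell_dim X a) + int (card b) = k + 1"
    if "(a, b) \<in> ?S" for a b
    using that cochains_zero[OF \<phi>, of "(a, b)"] cells_of_dim_product_simplex[of a b X n k] by auto
  have le: "cochain_norm ?Z (cone v \<phi>) \<le> (\<Sum>(a, b)\<in>?S. of_bool (v \<in> b))" for v
  proof -
    let ?T = "{(a, b) \<in> cells ?Z. cone v \<phi> (a, b) \<noteq> 0}"
    have "(\<lambda>(a, b). (a, insert v b)) ` ?T \<subseteq> {\<sigma> \<in> ?S. v \<in> snd \<sigma>}"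
    proof (rule image_subsetI)
      fix \<sigma> assume "\<sigma> \<in> ?T"
      then obtain a b where \<sigma>: "\<sigma> = (a, b)" and ab: "(a, b) \<in> cells ?Z" "cone v \<phi> (a, b) \<noteq> 0"
        by blast
      then have *: "v \<notin> b" "b \<noteq> {}" "\<phi> (a, insert v b) \<noteq> 0"
        by (auto simp: cone_def split: if_splits)
      then have "(a, insert v b) \<in> cells_of_dim ?Z k" using cochains_zero[OF \<phi>] by blast
      then have "(a, insert v b) \<in> cells ?Z" by (simp add: cells_of_dim_def)
      moreover have "finite b" using ab
        by (auto simp: product_complex_def simplex_def intro: finite_subset)
      ultimately show "(\<lambda>(a, b). (a, insert v b)) \<sigma> \<in> {\<sigma> \<in> ?S. v \<in> snd \<sigma>}"
        using * by (auto simp: \<sigma>)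
    qed
    moreover have "inj_on (\<lambda>(a, b). (a, insert v b)) ?T"
      by (auto simp: inj_on_def cone_def split: if_splits)
    ultimately have "card ?T \<le> card {\<sigma> \<in> ?S. v \<in> snd \<sigma>}"
      using finS by (intro card_inj_on_le) auto
    also have "\<dots> = (\<Sum>\<sigma>\<in>?S. of_bool (v \<in> snd \<sigma>))"
      using finS by (simp add: Int_def)
    finally show ?thesis by (simp add: cochain_norm_def case_prod_unfold)
  qed
  have "(\<Sum>v\<in>{1..n}. cochain_norm ?Z (cone v \<phi>)) \<le> (\<Sum>v\<in>{1..n}. \<Sum>(a, b)\<in>?S. of_bool (v \<in> b))"
    by (intro sum_mono le)
  also have "\<dots> = (\<Sum>(a, b)\<in>?S. \<Sum>v\<in>{1..n}. of_bool (v \<in> b))"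
    by (subst sum.swap) (simp add: case_prod_unfold)
  also have "\<dots> \<le> (\<Sum>(a, b)\<in>?S. min n (nat (k + 1)))"
  proof (rule sum_mono)
    fix \<sigma> assume \<sigma>: "\<sigma> \<in> ?S"
    obtain a b where ab: "\<sigma> = (a, b)" by force
    with \<sigma> have b: "b \<subseteq> {1..n}" "int (cell_dim X a) + int (card b) = k + 1"
      using inS[of a b] by auto
    have "(\<Sum>v\<in>{1..n}. of_bool (v \<in> b)) = card b" using b(1) by (simp add: Int_absorb1)
    \<comment> \<open>The factor in \<open>X\<close> has dimension at least 0, which leaves at most
      \<open>k + 1\<close> vertices for \<open>b\<close>.\<close>
    also have "card b \<le> min n (nat (k + 1))"
      using b card_mono[OF _ b(1)] by simp
    finally show "(case \<sigma> of (a, b) \<Rightarrow> \<Sum>v\<in>{1..n}. of_bool (v \<in> b)) \<le>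
        (case \<sigma> of (a, b) \<Rightarrow> min n (nat (k + 1)))"
      by (simp add: ab)
  qed
  finally show ?thesis by (simp add: case_prod_unfold mult.commute)
qed

text \<open>The copies of \<open>X\<close> over the vertices partition the cells with
  \<open>card b = 1\<close>. These are the cells missing from the bound for cones, so the two counts
  together exhaust the support.\<close>

lemma sum_cochain_norm_restrict:
  "(\<Sum>v\<in>{1..n}. cochain_norm X (\<lambda>a. \<phi> (a, {v}))) =
    card {(a, b) \<in> cells (X \<times>\<^sub>c simplex n). \<phi> (a, b) \<noteq> 0 \<and> card b = 1}"
proof -
  let ?f = "\<lambda>(v, a). (a, {v})"
  have "{(a, b) \<in> cells (X \<times>\<^sub>c simplex n). \<phi> (a, b) \<noteq> 0 \<and> card b = 1} =
      ?f ` (SIGMA v:{1..n}. {a \<in> cells X. \<phi> (a, {v}) \<noteq> 0})"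
    by (auto simp: product_complex_def simplex_def card_1_singleton_iff image_iff)
  moreover have "inj_on ?f (SIGMA v:{1..n}. {a \<in> cells X. \<phi> (a, {v}) \<noteq> 0})"
    by (auto simp: inj_on_def)
  ultimately have "card {(a, b) \<in> cells (X \<times>\<^sub>c simplex n). \<phi> (a, b) \<noteq> 0 \<and> card b = 1} =
      card (SIGMA v:{1..n}. {a \<in> cells X. \<phi> (a, {v}) \<noteq> 0})"
    by (simp only: card_image)
  also have "\<dots> = (\<Sum>v\<in>{1..n}. cochain_norm X (\<lambda>a. \<phi> (a, {v})))"
    unfolding cochain_norm_def using finite_cells by (intro card_SigmaI) auto
  finally show ?thesis ..
qed

end

section \<open>The Cheeger bound for the product\<close>

theorem theorem4p4:
  fixes X :: "'a cell_complex" and n :: nat and k :: int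
  assumes "finite_cell_complex X" and "n \<ge> 2" and "k \<ge> 0"
  shows "cheeger k (X \<times>\<^sub>c simplex n) \<ge>
    min (cheeger k X) (ereal (max 1 (real n / (real_of_int k + 2))))"
proof -
  interpret finite_cell_complex X by fact
  let ?Z = "X \<times>\<^sub>c simplex n"
  let ?M = "max 1 (real n / (real_of_int k + 2))"
  interpret Z: finite_cell_complex ?Z
    by (intro finite_cell_complex_product finite_cell_complex_simplex assms)
  have "0 \<le> cheeger k X"
    unfolding cheeger_def by (intro INF_greatest) simp
  then have "0 \<le> min (cheeger k X) (ereal ?M)" by (simp add: le_max_iff_disj)
  moreover have "min (cheeger k X) (ereal ?M) \<le> ereal ?M" by (rule min.cobounded2)
  \<comment> \<open>The Cheeger constant of \<open>X\<close> may be infinite, but \<open>?M\<close>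
    is finite, so the minimum is a real number and \<open>le_cheeger_iff\<close> applies to
    it.\<close>
  ultimately obtain c where c: "min (cheeger k X) (ereal ?M) = ereal c" "c \<ge> 0"
    by (cases "min (cheeger k X) (ereal ?M)") (auto simp del: ereal_max)
  have cX: "ereal c \<le> cheeger k X" and cM: "c \<le> ?M"
    by (metis c(1) min.cobounded1) (metis c(1) ereal_less_eq(3) min.cobounded2)
  \<comment> \<open>In fact \<open>?M\<close> equals \<open>n / min n (k + 2)\<close>, so the bound
    on the number of vertices of a simplex is matched exactly.\<close>
  have cn: "c * min n (nat (k + 2)) \<le> n"
  proof -
    have "?M * min n (nat (k + 2)) \<le> n"
    proof (cases "real n / (real_of_int k + 2) \<le> 1")
      case False
      have "real n / (real_of_int k + 2) * min n (nat (k + 2)) \<le>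
          real n / (real_of_int k + 2) * (real_of_int k + 2)"
        using assms(3) by (intro mult_left_mono) auto
      with False assms(3) show ?thesis by simp
    qed simp
    moreover have "c * min n (nat (k + 2)) \<le> ?M * min n (nat (k + 2))"
      using cM by (intro mult_right_mono) auto
    ultimately show ?thesis by linarith
  qed
  have "c * cosystolic_norm ?Z k \<phi> \<le> cochain_norm ?Z (coboundary ?Z k \<phi>)"
    if \<phi>: "\<phi> \<in> cochains ?Z k" for \<phi>
  proof -
    let ?d = "coboundary ?Z k \<phi>"
    \<comment> \<open>With \<open>P\<close> as \<open>m \<noteq> 1\<close> or \<open>m = 1\<close>,
      the support of the coboundary splits by whether the simplex factor is a vertex.\<close>
    let ?S = "\<lambda>P. {(a, b) \<in> cells ?Z. ?d (a, b) \<noteq> 0 \<and> P (card b)}"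
    \<comment> \<open>The coboundary has degree \<open>k + 1\<close>, which turns the factor
      \<open>k + 1\<close> of the cone bound into \<open>k + 2\<close>.\<close>
    have cone: "(\<Sum>v\<in>{1..n}. cochain_norm ?Z (cone v ?d)) \<le>
        min n (nat (k + 2)) * card (?S (\<lambda>m. m \<noteq> 1))"
      using sum_cochain_norm_cone_le[OF coboundary_in_cochains, of n k \<phi>] by (simp add: add.assoc)
    have restr: "c * cosystolic_norm X k (\<lambda>a. \<phi> (a, {v})) \<le> cochain_norm X (\<lambda>a. ?d (a, {v}))"
      if "v \<in> {1..n}" for v
      using cX[unfolded le_cheeger_iff, rule_format, OF restrict_in_cochains[OF \<phi>, of v]]
      by (simp only: coboundary_restrict[OF \<phi> that])
    \<comment> \<open>Averaging: the estimate is summed over all \<open>v\<close>, and the factor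
      \<open>n\<close> is cancelled at the end.\<close>
    have "n * (c * cosystolic_norm ?Z k \<phi>) = (\<Sum>v\<in>{1..n}. c * cosystolic_norm ?Z k \<phi>)"
      by simp
    also have "\<dots> \<le> (\<Sum>v\<in>{1..n}. c * cochain_norm ?Z (cone v ?d) +
        n * cochain_norm X (\<lambda>a. ?d (a, {v})))"
    proof (rule sum_mono)
      fix v assume v: "v \<in> {1..n}"
      have "c * cosystolic_norm ?Z k \<phi> \<le>
          c * real (cochain_norm ?Z (cone v ?d) + n * cosystolic_norm X k (\<lambda>a. \<phi> (a, {v})))"
        using cosystolic_norm_product_simplex_le[OF \<phi> v] c(2) by (intro mult_left_mono of_nat_mono)
      also have "\<dots> = c * cochain_norm ?Z (cone v ?d) +
          n * (c * cosystolic_norm X k (\<lambda>a. \<phi> (a, {v})))"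
        by (simp add: algebra_simps)
      also have "\<dots> \<le> c * cochain_norm ?Z (cone v ?d) + n * cochain_norm X (\<lambda>a. ?d (a, {v}))"
        using mult_left_mono[OF restr[OF v], of "real n"] by simp
      finally show "c * cosystolic_norm ?Z k \<phi> \<le>
          c * cochain_norm ?Z (cone v ?d) + n * cochain_norm X (\<lambda>a. ?d (a, {v}))" by simp
    qed
    also have "\<dots> = c * real (\<Sum>v\<in>{1..n}. cochain_norm ?Z (cone v ?d)) +
        n * real (\<Sum>v\<in>{1..n}. cochain_norm X (\<lambda>a. ?d (a, {v})))"
      by (simp add: sum.distrib sum_distrib_left)
    also have "\<dots> \<le> c * real (min n (nat (k + 2)) * card (?S (\<lambda>m. m \<noteq> 1))) +
        n * real (card (?S (\<lambda>m. m = 1)))"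
      unfolding sum_cochain_norm_restrict
      using cone c(2) by (intro add_right_mono mult_left_mono of_nat_mono) simp_all
    \<comment> \<open>By \<open>cn\<close> the cells counted by the cones also get weight at most
      \<open>n\<close>, the same as those over vertices.\<close>
    also have "\<dots> \<le> n * real (card (?S (\<lambda>m. m \<noteq> 1))) + n * real (card (?S (\<lambda>m. m = 1)))"
      using mult_right_mono[OF cn, of "card (?S (\<lambda>m. m \<noteq> 1))"] by (simp add: mult.assoc)
    also have "\<dots> = n * real (card (?S (\<lambda>m. m \<noteq> 1)) + card (?S (\<lambda>m. m = 1)))"
      by (simp add: algebra_simps)
    also have "card (?S (\<lambda>m. m \<noteq> 1)) + card (?S (\<lambda>m. m = 1)) =
        card (?S (\<lambda>m. m \<noteq> 1) \<union> ?S (\<lambda>m. m = 1))"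
      by (intro card_Un_disjoint[symmetric]) (auto intro: finite_subset[OF _ Z.finite_cells])
    also have "?S (\<lambda>m. m \<noteq> 1) \<union> ?S (\<lambda>m. m = 1) = {\<sigma> \<in> cells ?Z. ?d \<sigma> \<noteq> 0}"
      by auto
    finally show ?thesis
      using assms(2) by (simp add: cochain_norm_def)
  qed
  then show ?thesis unfolding c(1) Z.le_cheeger_iff by blast
qed

end
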